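(* Let $\alpha>-1$ and $t\in\mathbb{R}$. The recurrence coefficients $\beta_n=\beta_n(t)$ satisfy, for every integer $n\ge 1$, the second-order nonlinear difference equation $$(n-2t\beta_n)^2+2\alpha(n-2t\beta_n)-\beta_n\,(2n-1+2\alpha-2t\beta_{n-1}-2t\beta_n)(2n+1+2\alpha-2t\beta_n-2t\beta_{n+1})=0,$$ with the initial conditions $$\beta_0=0,\qquad \beta_1=\frac{\Phi\left(\frac32,\frac52+\alpha;-t\right)}{(3+2\alpha)\,\Phi\left(\frac12,\frac32+\alpha;-t\right)}.$$
   Context: For $\alpha>-1$ and $t\in\mathbb{R}$ let $w(x,t)=(1-x^2)^{\alpha}e^{-tx^2}$, $x\in[-1,1]$. Let $P_n(x,t)$, $n=0,1,2,\ldots$, be the monic polynomials of degree $n$ orthogonal with respect to $w$: $\int_{-1}^1P_m(x,t)P_n(x,t)w(x,t)\,dx=h_n(t)\delta_{mn}$. Since $w$ is even they satisfy the three-term recurrence $xP_n(x,t)=P_{n+1}(x,t)+\beta_n(t)P_{n-1}(x,t)$ with $P_0=1$, $P_{-1}=0$ and $\beta_0(t):=0$; for $n\ge1$, $\beta_n(t)=h_n(t)/h_{n-1}(t)$. $\Phi(a,b;z)=\sum_{k\ge0}\frac{(a)_k}{(b)_k}\frac{z^k}{k!}$ is Kummer's confluent hypergeometric function, where $(a)_0=1$, $(a)_k=a(a+1)\cdots(a+k-1)$. *)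

theory Defs
  imports
    "HOL-Analysis.Analysis"
    "HOL-Computational_Algebra.Polynomial"
begin

text \<open>
  Pitfall: in HOL \<^term>\<open>(0::real) powr \<alpha> = 0\<close> for every \<open>\<alpha>\<close>, so the value at the two endpoints
  \<open>x = 1\<close> and \<open>x = -1\<close> is \<open>0\<close> even when \<open>\<alpha> \<le> 0\<close>. This null set does not affect the integrals
  below.
\<close>
definition weight :: "real \<Rightarrow> real \<Rightarrow> real \<Rightarrow> real" where
  "weight \<alpha> t x = (1 - x\<^sup>2) powr \<alpha> * exp (- t * x\<^sup>2)"

definition monic_orthogonal_polys ::
    "(real \<Rightarrow> real) \<Rightarrow> (nat \<Rightarrow> real poly) \<Rightarrow> (nat \<Rightarrow> real) \<Rightarrow> bool" where
  "monic_orthogonal_polys w P h \<longleftrightarrow>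
     (\<forall>n. degree (P n) = n \<and> lead_coeff (P n) = 1) \<and>
     (\<forall>m n. integral {-1..1} (\<lambda>x. poly (P m) x * poly (P n) x * w x) = (if m = n then h n else 0))"

text \<open>
  The conditional encodes the convention \<open>P\<^sub>-\<^sub>1 = 0\<close>; since the recurrence then says nothing about
  \<open>\<beta> 0\<close>, its value is fixed by convention.
\<close>
definition recurrence_coeffs :: "(nat \<Rightarrow> real poly) \<Rightarrow> (nat \<Rightarrow> real) \<Rightarrow> bool" where
  "recurrence_coeffs P \<beta> \<longleftrightarrow>
     \<beta> 0 = 0 \<and>
     (\<forall>n. [:0, 1:] * P n = P (n + 1) + smult (\<beta> n) (if n = 0 then 0 else P (n - 1)))"

definition kummer :: "real \<Rightarrow> real \<Rightarrow> real \<Rightarrow> real" where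
  "kummer a b z = (\<Sum>k. pochhammer a k / pochhammer b k * (z ^ k / fact k))"

end

theory Submission
  imports Defs
begin

text \<open>
  The difference equation is the statement that a two-by-two determinant vanishes. The weight
  satisfies a Pearson equation, \<open>((1 - x\<^sup>2) w)' = -2 x (\<alpha> + 1 + t - t x\<^sup>2) w\<close>. Integrating against
  products of the orthogonal polynomials turns it into the ladder relation
  \<open>(1 - x\<^sup>2) P\<^sub>n' = \<beta>\<^sub>n (R\<^sub>n + 2 t (1 - x\<^sup>2)) P\<^sub>n\<^sub>-\<^sub>1 - S\<^sub>n x P\<^sub>n\<close> (lemma \<open>structure_relation\<close>), where
  \<open>S\<^sub>n = n - 2 t \<beta>\<^sub>n\<close> and \<open>R\<^sub>n = 2 n + 1 + 2 \<alpha> - 2 t (\<beta>\<^sub>n + \<beta>\<^sub>n\<^sub>+\<^sub>1)\<close>. At the singular point \<open>x = 1\<close> the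
  derivative disappears, leaving \<open>S\<^sub>n P\<^sub>n(1) = \<beta>\<^sub>n R\<^sub>n P\<^sub>n\<^sub>-\<^sub>1(1)\<close>. The same relation for \<open>n - 1\<close>, combined
  with the three-term recurrence at \<open>x = 1\<close>, reads \<open>(S\<^sub>n + 2 \<alpha>) P\<^sub>n\<^sub>-\<^sub>1(1) = R\<^sub>n\<^sub>-\<^sub>1 P\<^sub>n(1)\<close>. These are two
  linear equations for \<open>P\<^sub>n\<^sub>-\<^sub>1(1)\<close> and \<open>P\<^sub>n(1)\<close>, which cannot both be zero; hence
  \<open>S\<^sub>n (S\<^sub>n + 2 \<alpha>) = \<beta>\<^sub>n R\<^sub>n\<^sub>-\<^sub>1 R\<^sub>n\<close>, and this is the difference equation.

  For the initial value, \<open>\<beta>\<^sub>1 = h\<^sub>1 / h\<^sub>0\<close> is the quotient of the second and the zeroth moment of \<open>w\<close>.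
  The Pearson equation at \<open>t = 0\<close> gives a first-order recursion for the even moments of
  \<open>(1 - x\<^sup>2)\<^sup>\<alpha>\<close>, hence quotients of Pochhammer symbols, and integrating the exponential series term by
  term assembles them into Kummer functions.
\<close>

section \<open>Orthogonal polynomials for a functional with a Pearson equation\<close>

abbreviation X :: "real poly" where "X \<equiv> [:0, 1:]"

text \<open>
  The algebraic half of the argument uses the weight only through the functional
  \<open>L p = \<integral> p w\<close>: positivity, and the Pearson equation, which is the distributional identity
  \<open>((1 - x\<^sup>2) w)' = -2 x (\<alpha> + 1 + t - t x\<^sup>2) w\<close> tested against polynomials. At
  \<open>n = 0\<close> the recurrence reads \<open>x P\<^sub>0 = P\<^sub>1\<close>: the truncated index in \<open>P (0 - 1)\<close> meets the coefficient
  \<open>\<beta> 0 = 0\<close>.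
\<close>
locale semiclassical_functional =
  fixes L :: "real poly \<Rightarrow> real" and \<alpha> t :: real
    and P :: "nat \<Rightarrow> real poly" and h \<beta> :: "nat \<Rightarrow> real"
  assumes L_add: "L (p + q) = L p + L q"
    and L_smult: "L (smult c p) = c * L p"
    and L_pos: "p \<noteq> 0 \<Longrightarrow> L (p * p) > 0"
    and pearson: "L ((1 - X * X) * pderiv p) = 2 * L ((smult (\<alpha> + 1 + t) X - smult t (X * X * X)) * p)"
    and degree_P: "degree (P n) = n"
    and lead_coeff_P: "lead_coeff (P n) = 1"
    and orthogonal: "L (P m * P n) = (if m = n then h n else 0)"
    and beta_0: "\<beta> 0 = 0"
    and recurrence: "X * P n = P (Suc n) + smult (\<beta> n) (P (n - 1))"
begin

lemma L_0: "L 0 = 0"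
  using L_smult[of 0 0] by simp

lemma L_minus: "L (- p) = - L p"
  using L_smult[of "-1" p] by simp

lemma L_diff: "L (p - q) = L p - L q"
  using L_add[of p "- q"] by (simp add: L_minus)

lemmas L_linear = L_0 L_minus L_add L_diff L_smult

lemma P_neq_0: "P n \<noteq> 0"
  using lead_coeff_P[of n] by auto

lemma coeff_P: "coeff (P n) n = 1"
  using lead_coeff_P[of n] by (simp add: degree_P)

lemma h_pos: "h n > 0"
  using L_pos[OF P_neq_0, of n] by (simp add: orthogonal)

lemma degree_reduce:
  assumes "degree q \<le> n"
  shows "degree (q - smult (coeff q n) (P n)) < n \<or> q = smult (coeff q n) (P n)"
proof (cases "q - smult (coeff q n) (P n) = 0")
  case False
  let ?r = "q - smult (coeff q n) (P n)"
  have "degree ?r \<le> n"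
    using assms degree_P[of n] by (intro degree_diff_le) (auto intro: order_trans[OF degree_smult_le])
  moreover have "coeff ?r n = 0"
    by (simp add: coeff_P)
  ultimately show ?thesis
    using False by (metis le_neq_implies_less leading_coeff_0_iff)
qed simp

text \<open>
  As \<open>P k\<close> has degree exactly \<open>k\<close>, subtracting a multiple of \<open>P n\<close> lowers the degree; so
  \<open>P 0, \<dots>, P n\<close> span the polynomials of degree at most \<open>n\<close>, and orthogonality to these finitely many
  elements suffices.
\<close>
lemma orthogonal_span:
  assumes "\<And>k. k \<le> n \<Longrightarrow> L (p * P k) = 0" and "degree q \<le> n"
  shows "L (p * q) = 0"
  using assms
proof (induction n arbitrary: q rule: less_induct)
  case (less n)
  let ?r = "q - smult (coeff q n) (P n)"
  have "L (p * ?r) = 0"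
  proof (cases "?r = 0")
    case False
    then have "degree ?r < n"
      using degree_reduce[OF less.prems(2)] by auto
    then show ?thesis
      using less.IH[of "degree ?r" ?r] less.prems(1) by force
  qed (simp add: L_0)
  then show ?case
    using less.prems(1)[of n] by (simp add: right_diff_distrib L_linear)
qed

lemma orthogonal_lower_degree:
  assumes "degree q < n" shows "L (P n * q) = 0"
  by (rule orthogonal_span[of "n - 1"]) (use assms in \<open>auto simp: orthogonal\<close>)

lemma L_P_mult_eq_coeff:
  assumes "degree q \<le> n" shows "L (P n * q) = coeff q n * h n"
proof -
  have "L (P n * (q - smult (coeff q n) (P n))) = 0"
    using degree_reduce[OF assms] by (auto intro: orthogonal_lower_degree simp: L_0)
  then show ?thesis
    by (simp add: right_diff_distrib L_linear orthogonal)
qed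

text \<open>
  This is how polynomial identities are proved below: by the spanning property \<open>p\<close> is orthogonal to
  itself, and the functional is positive definite.
\<close>
lemma orthogonal_complete:
  assumes "degree p \<le> n" and "\<And>k. k \<le> n \<Longrightarrow> L (P k * p) = 0"
  shows "p = 0"
  using orthogonal_span[of n p p] L_pos[of p] assms by (force simp: mult.commute)

lemma L_X_symmetric: "L ((X * p) * q) = L (p * (X * q))"
  by (simp add: mult.commute mult.left_commute)

text \<open>
  Both sides evaluate \<open>L (x P\<^sub>n P\<^sub>n\<^sub>+\<^sub>1)\<close>, with the recurrence applied to either factor.
\<close>
lemma h_Suc: "h (Suc n) = \<beta> (Suc n) * h n"
proof -
  have "L (P (Suc n) * (X * P n)) = L ((X * P (Suc n)) * P n)"
    by (simp only: L_X_symmetric)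
  then show ?thesis
    unfolding recurrence by (simp only: ring_distribs L_linear mult_smult_left mult_smult_right orthogonal)
      (cases n; simp add: beta_0)
qed

lemma beta_Suc_neq_0: "\<beta> (Suc n) \<noteq> 0"
  using h_pos[of "Suc n"] h_Suc[of n] by auto

lemma beta_Suc: "\<beta> (Suc n) = h (Suc n) / h n"
  using h_Suc[of n] h_pos[of n] by (simp add: field_simps)

text \<open>
  The Pearson equation for a product. On the right the factors \<open>x\<close> are attached to \<open>p\<close> and \<open>q\<close> so
  that the recurrence can be applied to each factor when these are members of the sequence.
\<close>
lemma pearson_by_parts:
  "L ((1 - X * X) * pderiv p * q) =
     2 * (\<alpha> + 1 + t) * L ((X * p) * q) - 2 * t * L ((X * p) * (X * (X * q)))
     - L ((1 - X * X) * p * pderiv q)"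
proof -
  have "L ((1 - X * X) * pderiv p * q) + L ((1 - X * X) * p * pderiv q) = L ((1 - X * X) * pderiv (p * q))"
    unfolding L_add[symmetric]
    by (rule arg_cong[where f = L]) (simp only: pderiv_mult ring_distribs mult_ac add_ac)
  also have "\<dots> = 2 * L (smult (\<alpha> + 1 + t) (X * p * q) - smult t ((X * p) * (X * (X * q))))"
    unfolding pearson
    by (rule arg_cong[where f = "\<lambda>p. 2 * L p"])
      (simp only: left_diff_distrib right_diff_distrib mult_smult_left mult_smult_right mult_ac)
  finally show ?thesis
    unfolding L_diff L_smult by (simp only: algebra_simps)
qed

text \<open>
  The quantities \<open>S n\<close> and \<open>\<beta> n * R n\<close> are the residues at \<open>x = 1\<close>, up to constant factors, of the two
  rational coefficients in the ladder relation that expresses \<open>P\<^sub>n'\<close> through \<open>P\<^sub>n\<close> and \<open>P\<^sub>n\<^sub>-\<^sub>1\<close>.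
\<close>
definition S :: "nat \<Rightarrow> real" where "S n = real n - 2 * t * \<beta> n"
definition R :: "nat \<Rightarrow> real" where "R n = 2 * real n + 1 + 2 * \<alpha> - 2 * t * \<beta> n - 2 * t * \<beta> (Suc n)"

lemma degree_X_mult: "degree (X * p) \<le> Suc (degree p)"
  by (simp add: degree_pCons_le)

lemma degree_pderiv_term: "degree ((1 - X * X) * pderiv (P n)) \<le> Suc n"
proof (cases n)
  case 0
  then have "pderiv (P n) = 0" using degree_P[of n] by (simp add: pderiv_eq_0_iff)
  then show ?thesis by simp
next
  case (Suc k)
  have "degree (1 - X * X) \<le> 2"
    by (intro degree_diff_le) auto
  then show ?thesis
    using degree_mult_le[of "1 - X * X" "pderiv (P n)"] Suc by (simp add: degree_pderiv degree_P)
qed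

lemma coeff_pderiv_term: "coeff ((1 - X * X) * pderiv (P n)) (Suc n) = - real n"
proof -
  have "coeff ((1 - X * X) * p) (Suc n) = coeff p (Suc n) - (if n = 0 then 0 else coeff p (n - 1))" for p :: "real poly"
    by (simp add: left_diff_distrib coeff_pCons split: nat.split)
  then show ?thesis
    by (auto simp: coeff_pderiv coeff_P coeff_eq_0 degree_P)
qed

lemma L_X_P_P: "L ((X * P m) * P n) = (if n = Suc m then h n else if m = Suc n then h m else 0)"
  unfolding recurrence
  by (simp only: ring_distribs L_linear mult_smult_left mult_smult_right orthogonal)
    (cases m; auto simp: beta_0 h_Suc)

lemma L_P_X_P: "L (P m * (X * P n)) = (if n = Suc m then h n else if m = Suc n then h m else 0)"
  unfolding L_X_symmetric[symmetric] by (rule L_X_P_P)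

text \<open>
  The ladder relation
  \<open>(1 - x\<^sup>2) P\<^sub>n' = \<beta>\<^sub>n (R\<^sub>n + 2 t (1 - x\<^sup>2)) P\<^sub>n\<^sub>-\<^sub>1 - S\<^sub>n x P\<^sub>n\<close>, written with \<open>Suc n\<close> for \<open>n\<close>.
  The difference \<open>D\<close> of the two sides has degree at most one more than \<open>P\<^sub>n\<close>, so it is enough that it
  is orthogonal to all \<open>P k\<close> up to that degree. Against low degrees the Pearson equation leaves only
  terms that combine through the recurrence to \<open>L (x\<^sup>2 P\<^sub>n\<^sub>+\<^sub>1 P\<^sub>k) = 0\<close>. Three top degrees remain: the
  highest fixes \<open>S\<^sub>n\<close> (it compares leading coefficients), the next vanishes because the recurrence
  has no diagonal term (\<open>x P\<^sub>n\<close> has no component along \<open>P\<^sub>n\<close>), and the lowest of the three fixes \<open>R\<^sub>n\<close>.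
\<close>
lemma structure_relation:
  "(1 - X * X) * pderiv (P (Suc n)) =
     smult (\<beta> (Suc n)) (smult (R (Suc n) + 2 * t) (P n) - smult (2 * t) (X * (X * P n)))
     - smult (S (Suc n)) (X * P (Suc n))"
proof -
  define b where "b = \<beta> (Suc n)"
  define A where "A = (1 - X * X) * pderiv (P (Suc n))"
  define D where "D = A - smult (b * (R (Suc n) + 2 * t)) (P n) + smult (2 * t * b) (X * (X * P n))
     + smult (S (Suc n)) (X * P (Suc n))"
  note expand = ring_distribs L_linear mult_smult_left mult_smult_right
  have LD: "L (P k * D) = L (A * P k) - b * (R (Suc n) + 2 * t) * L (P k * P n)
      + 2 * t * b * L ((X * P n) * (X * P k)) + S (Suc n) * L ((X * P (Suc n)) * P k)" for k
    unfolding D_def by (simp only: expand L_X_symmetric) (simp only: mult_ac)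
  have LA: "L (A * P k) = 2 * (\<alpha> + 1 + t) * L ((X * P (Suc n)) * P k)
     - 2 * t * L ((X * P (Suc n)) * (X * (X * P k))) - L (P (Suc n) * ((1 - X * X) * pderiv (P k)))" for k
    unfolding A_def pearson_by_parts by (simp only: mult_ac)
  have "degree D \<le> n + 2"
    unfolding D_def A_def
    using degree_pderiv_term[of "Suc n"] degree_X_mult[of "P n"] degree_X_mult[of "X * P n"]
      degree_X_mult[of "P (Suc n)"] degree_P[of n] degree_P[of "Suc n"]
    by (intro degree_add_le degree_diff_le order_trans[OF degree_smult_le]) linarith+
  moreover have "L (P k * D) = 0" if "k \<le> n + 2" for k
  proof -
    consider "k < n" | "k = n" | "k = n + 1" | "k = n + 2"
      using \<open>k \<le> n + 2\<close> by linarith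
    then show ?thesis
    proof cases
      case 1
      \<comment> \<open>The two surviving terms combine to a multiple of \<open>L (x\<^sup>2 P\<^sub>k (x P\<^sub>n\<^sub>+\<^sub>1 - b P\<^sub>n)) = L (x\<^sup>2 P\<^sub>k P\<^sub>n\<^sub>+\<^sub>2)\<close>.\<close>
      have "L (P (Suc n) * ((1 - X * X) * pderiv (P k))) = 0"
        using 1 degree_pderiv_term[of k] by (intro orthogonal_lower_degree) linarith
      moreover have "L ((X * P (Suc n)) * (X * (X * P k))) = b * L ((X * P n) * (X * P k))"
      proof -
        have "degree (X * (X * P k)) < n + 2"
          using 1 degree_X_mult[of "P k"] degree_X_mult[of "X * P k"] degree_P[of k] by linarith
        then have "L (P (Suc (Suc n)) * (X * (X * P k))) = 0"
          by (intro orthogonal_lower_degree) simp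
        then show ?thesis
          unfolding L_X_symmetric[of "P n"] recurrence[of "Suc n"]
          by (simp only: expand) (simp add: b_def)
      qed
      ultimately show ?thesis
        using 1 unfolding LD LA by (simp add: L_X_P_P orthogonal del: mult_pCons_left)
    next
      case 2
      have "L (P (Suc n) * ((1 - X * X) * pderiv (P n))) = - real n * h (Suc n)"
        using degree_pderiv_term[of n] coeff_pderiv_term[of n] by (subst L_P_mult_eq_coeff) auto
      moreover have "L ((X * P n) * (X * P n)) = h (Suc n) + \<beta> n * h n"
        unfolding recurrence
        by (simp only: expand orthogonal) (cases n; simp add: beta_0 h_Suc)
      moreover have "L ((X * P (Suc n)) * (X * (X * P n))) =
          (\<beta> (Suc (Suc n)) + b + \<beta> n) * h (Suc n)"
      proof -
        have "L ((X * P (Suc n)) * (X * (X * P n))) = L ((X * P (Suc n)) * (X * P (Suc n)))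
            + \<beta> n * L ((X * P (n - 1)) * (X * P (Suc n)))"
          unfolding recurrence[of n] by (simp only: expand mult_ac)
        moreover have "\<beta> n * L ((X * P (n - 1)) * (X * P (Suc n))) = \<beta> n * h (Suc n)"
          unfolding recurrence[of "n - 1"] recurrence[of "Suc n"]
          by (simp only: expand orthogonal) (cases n; auto simp: beta_0 h_Suc)
        moreover have "L ((X * P (Suc n)) * (X * P (Suc n))) = (\<beta> (Suc (Suc n)) + b) * h (Suc n)"
          unfolding recurrence[of "Suc n"]
          by (simp only: expand orthogonal) (simp add: h_Suc b_def left_diff_distrib distrib_right)
        ultimately show ?thesis
          by (simp only: ring_distribs)
      qed
      ultimately show ?thesis
        using 2 unfolding LD LA
        by (simp add: L_X_P_P orthogonal R_def S_def del: mult_pCons_left)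
          (simp add: b_def h_Suc algebra_simps)
    next
      case 3
      \<comment> \<open>Integrating by parts exchanges the two factors, and the odd moments of \<open>(P\<^sub>n\<^sub>+\<^sub>1)\<^sup>2\<close> that it
        produces vanish, so \<open>L (A P\<^sub>n\<^sub>+\<^sub>1)\<close> equals its own negative.\<close>
      have "L (A * P (Suc n)) = 0"
      proof -
        have "L ((X * P (Suc n)) * (X * (X * P (Suc n)))) = 0"
          unfolding recurrence[of "Suc n"]
          by (simp only: expand L_P_X_P) simp
        moreover have "L (A * P (Suc n)) = L (P (Suc n) * ((1 - X * X) * pderiv (P (Suc n))))"
          unfolding A_def by (simp only: mult_ac)
        ultimately show ?thesis
          using LA[of "Suc n"] by (simp add: L_X_P_P del: mult_pCons_left)
      qed
      moreover have "L ((X * P n) * (X * P (Suc n))) = 0"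
        unfolding recurrence by (simp only: expand orthogonal) (cases n; auto simp: beta_0)
      ultimately show ?thesis
        using 3 unfolding LD by (simp add: L_X_P_P orthogonal del: mult_pCons_left)
    next
      case 4
      have "L (P (Suc (Suc n)) * ((1 - X * X) * pderiv (P (Suc n)))) =
          - real (Suc n) * h (Suc (Suc n))"
        using degree_pderiv_term[of "Suc n"] by (simp only: L_P_mult_eq_coeff coeff_pderiv_term)
      then have "L (A * P k) = - real (Suc n) * h (Suc (Suc n))"
        using 4 by (simp only: A_def mult.commute[of "P _"] nat_arith.suc1 add_2_eq_Suc')
      moreover have "L ((X * P n) * (X * P (Suc (Suc n)))) = h (Suc (Suc n))"
        unfolding recurrence
        by (simp only: expand orthogonal) (cases n; simp add: beta_0 h_Suc)
      ultimately show ?thesis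
        using 4 unfolding LD
        by (simp add: L_X_P_P orthogonal del: mult_pCons_left) (simp add: S_def b_def algebra_simps)
    qed
  qed
  ultimately have "D = 0"
    by (rule orthogonal_complete)
  moreover have "D = (1 - X * X) * pderiv (P (Suc n)) -
     (smult (\<beta> (Suc n)) (smult (R (Suc n) + 2 * t) (P n) - smult (2 * t) (X * (X * P n)))
     - smult (S (Suc n)) (X * P (Suc n)))"
    unfolding D_def A_def b_def smult_diff_right smult_smult mult.commute[of "\<beta> (Suc n)"]
    by (simp only: diff_diff_eq2 diff_add_eq add.assoc diff_diff_eq)
  ultimately show ?thesis
    by (metis eq_iff_diff_eq_0)
qed

text \<open>
  At \<open>x = 1\<close> the derivative drops out. For \<open>n = 0\<close> both sides vanish, as \<open>S 0 = \<beta> 0 = 0\<close>.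
\<close>
lemma structure_relation_at_1:
  "S n * poly (P n) 1 = \<beta> n * R n * poly (P (n - 1)) 1"
proof (cases n)
  case (Suc m)
  then show ?thesis
    using arg_cong[OF structure_relation[of m], of "\<lambda>p. poly p 1"] by (simp add: algebra_simps)
qed (simp add: S_def beta_0)

lemma recurrence_at_1: "poly (P (Suc n)) 1 = poly (P n) 1 - \<beta> n * poly (P (n - 1)) 1"
  using arg_cong[OF recurrence[of n], of "\<lambda>p. poly p 1"] by simp

text \<open>
  The same relation one index lower, with \<open>P\<^sub>n\<^sub>-\<^sub>1(1)\<close> eliminated by the recurrence in favour of
  \<open>P\<^sub>n\<^sub>+\<^sub>1(1)\<close>. It closes up because \<open>R\<^sub>n - S\<^sub>n = S\<^sub>n\<^sub>+\<^sub>1 + 2 \<alpha>\<close>.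
\<close>
lemma structure_relation_at_1_shifted:
  "(S (Suc n) + 2 * \<alpha>) * poly (P n) 1 = R n * poly (P (Suc n)) 1"
proof -
  have "R n * poly (P (Suc n)) 1 = R n * poly (P n) 1 - S n * poly (P n) 1"
    unfolding recurrence_at_1 structure_relation_at_1 by (simp add: algebra_simps)
  moreover have "R n - S n = S (Suc n) + 2 * \<alpha>"
    by (simp add: R_def S_def)
  ultimately show ?thesis
    by (simp add: left_diff_distrib[symmetric])
qed

text \<open>
  Two consecutive zeros would propagate down the recurrence, whose coefficients are nonzero, to
  \<open>P\<^sub>0 = 1\<close>.
\<close>
lemma no_consecutive_zeros: "poly (P n) 1 \<noteq> 0 \<or> poly (P (Suc n)) 1 \<noteq> 0"
proof (induction n)
  case 0
  obtain a where "P 0 = [:a:]"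
    using degree_P[of 0] by (rule degree_eq_zeroE)
  then show ?case
    using coeff_P[of 0] by simp
next
  case (Suc n)
  then show ?case
    using recurrence_at_1[of "Suc n"] beta_Suc_neq_0[of n] by auto
qed

text \<open>
  The two relations at \<open>x = 1\<close> form a homogeneous linear system for the vector
  \<open>(P\<^sub>n(1), P\<^sub>n\<^sub>+\<^sub>1(1))\<close>. This vector is nonzero, so the determinant vanishes, which is the claim.
\<close>
theorem difference_equation:
  "(S (Suc n))\<^sup>2 + 2 * \<alpha> * S (Suc n) = \<beta> (Suc n) * R n * R (Suc n)"
proof -
  define \<rho> where "\<rho> k = poly (P k) 1" for k
  have E1: "S (Suc n) * \<rho> (Suc n) = \<beta> (Suc n) * R (Suc n) * \<rho> n"
    using structure_relation_at_1[of "Suc n"] by (simp add: \<rho>_def)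
  have E2: "(S (Suc n) + 2 * \<alpha>) * \<rho> n = R n * \<rho> (Suc n)"
    using structure_relation_at_1_shifted[of n] by (simp add: \<rho>_def)
  let ?d = "S (Suc n) * (S (Suc n) + 2 * \<alpha>) - \<beta> (Suc n) * R n * R (Suc n)"
  have "?d * \<rho> (Suc n) = 0" "?d * \<rho> n = 0"
    using E1 E2 by algebra+
  then have "?d = 0"
    using no_consecutive_zeros[of n] by (auto simp: \<rho>_def)
  then show ?thesis
    by (simp add: power2_eq_square algebra_simps)
qed

end

section \<open>The deformed Gegenbauer weight\<close>

text \<open>
  For \<open>\<alpha> < 0\<close> the weight is unbounded at the endpoints; its integral is the Beta integral under
  \<open>x \<mapsto> (1 + x) / 2\<close>.
\<close>
lemma integrable_jacobi_weight:
  fixes \<alpha> :: real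
  assumes "\<alpha> > -1"
  shows "(\<lambda>x. (1 - x\<^sup>2) powr \<alpha>) absolutely_integrable_on {-1..1}"
proof -
  have "((\<lambda>x. x powr (\<alpha> + 1 - 1) * (1 - x) powr (\<alpha> + 1 - 1)) has_integral Beta (\<alpha> + 1) (\<alpha> + 1)) (cbox 0 1)"
    using has_integral_Beta_real[of "\<alpha> + 1" "\<alpha> + 1"] assms by simp
  from has_integral_affinity'[OF this, of "1/2" "1/2"]
  have "(\<lambda>x. ((1 + x) / 2) powr \<alpha> * ((1 - x) / 2) powr \<alpha>) integrable_on {-1..1}"
    by (auto simp: integrable_on_def field_simps)
  then have "(\<lambda>x. 4 powr \<alpha> * (((1 + x) / 2) powr \<alpha> * ((1 - x) / 2) powr \<alpha>)) integrable_on {-1..1}"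
    by (rule integrable_on_mult_right)
  moreover have "4 powr \<alpha> * (((1 + x) / 2) powr \<alpha> * ((1 - x) / 2) powr \<alpha>) = (1 - x\<^sup>2) powr \<alpha>"
    if "x \<in> {-1..1}" for x
  proof -
    define a b where "a = (1 + x) / 2" and "b = (1 - x) / 2"
    have "1 - x\<^sup>2 = 4 * (a * b)"
      by (simp add: a_def b_def field_simps power2_eq_square)
    moreover have "a \<ge> 0" "b \<ge> 0"
      using that by (simp_all add: a_def b_def)
    ultimately show ?thesis
      by (simp add: powr_mult a_def[symmetric] b_def[symmetric])
  qed
  ultimately have "(\<lambda>x. (1 - x\<^sup>2) powr \<alpha>) integrable_on {-1..1}"
    by (rule integrable_eq) 
  then show ?thesis
    by (rule nonnegative_absolutely_integrable_1) simp
qed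

lemma integrable_continuous_times_weight:
  fixes \<alpha> t :: real
  assumes "\<alpha> > -1" and "continuous_on {-1..1} g"
  shows "(\<lambda>x. g x * weight \<alpha> t x) integrable_on {-1..1}"
proof -
  have cont: "continuous_on {-1..1} (\<lambda>x. g x * exp (- t * x\<^sup>2))"
    by (intro continuous_intros assms(2))
  have "(\<lambda>x. (g x * exp (- t * x\<^sup>2)) * (1 - x\<^sup>2) powr \<alpha>) absolutely_integrable_on {-1..1}"
  proof (rule absolutely_integrable_bounded_measurable_product_real)
    show "(\<lambda>x. g x * exp (- t * x\<^sup>2)) \<in> borel_measurable (lebesgue_on {-1..1})"
      by (rule continuous_imp_measurable_on_sets_lebesgue[OF cont]) simp
    show "bounded ((\<lambda>x. g x * exp (- t * x\<^sup>2)) ` {-1..1})"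
      by (intro compact_imp_bounded compact_continuous_image cont) simp
  qed (auto intro: integrable_jacobi_weight assms)
  then show ?thesis
    unfolding weight_def absolutely_integrable_on_def by (simp add: mult_ac)
qed

text \<open>
  The difference of the two sides is the integral of the derivative of \<open>p(x) (1 - x\<^sup>2) w(x)\<close>, which is
  continuous up to the endpoints and vanishes there because \<open>\<alpha> + 1 > 0\<close>.
\<close>
lemma pearson_weight:
  fixes \<alpha> t :: real
  assumes "\<alpha> > -1"
  shows "integral {-1..1} (\<lambda>x. poly ((1 - X * X) * pderiv p) x * weight \<alpha> t x) =
    2 * integral {-1..1} (\<lambda>x. poly ((smult (\<alpha> + 1 + t) X - smult t (X * X * X)) * p) x * weight \<alpha> t x)"
proof -
  let ?V = "(smult (\<alpha> + 1 + t) X - smult t (X * X * X)) * p"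
  define G where "G x = poly p x * ((1 - x\<^sup>2) powr (\<alpha> + 1) * exp (- t * x\<^sup>2))" for x :: real
  define g where "g x = poly ((1 - X * X) * pderiv p) x * weight \<alpha> t x - 2 * (poly ?V x * weight \<alpha> t x)" for x
  have "(g has_integral G 1 - G (-1)) {-1..1}"
  proof (rule fundamental_theorem_of_calculus_interior)
    show "continuous_on {-1..1} G"
      unfolding G_def using assms
      by (intro continuous_intros continuous_on_powr') (auto simp: abs_le_square_iff[symmetric] abs_square_le_1)
    fix x :: real assume x: "x \<in> {-1<..<1}"
    then have pos: "1 - x\<^sup>2 > 0"
      by (simp add: abs_square_less_1 abs_less_iff)
    have "(G has_real_derivative
        poly (pderiv p) x * ((1 - x\<^sup>2) powr (\<alpha> + 1) * exp (- t * x\<^sup>2)) +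
        poly p x * (((\<alpha> + 1) * (1 - x\<^sup>2) powr \<alpha> * (- 2 * x)) * exp (- t * x\<^sup>2)
          + (1 - x\<^sup>2) powr (\<alpha> + 1) * (exp (- t * x\<^sup>2) * (- 2 * t * x)))) (at x)"
      unfolding G_def using pos
      by (auto intro!: derivative_eq_intros simp: powr_diff)
    moreover have pow: "(1 - x\<^sup>2) powr (\<alpha> + 1) = (1 - x\<^sup>2) * (1 - x\<^sup>2) powr \<alpha>"
      using pos by (simp add: powr_add)
    have "poly (pderiv p) x * ((1 - x\<^sup>2) powr (\<alpha> + 1) * exp (- t * x\<^sup>2)) +
        poly p x * (((\<alpha> + 1) * (1 - x\<^sup>2) powr \<alpha> * (- 2 * x)) * exp (- t * x\<^sup>2)
          + (1 - x\<^sup>2) powr (\<alpha> + 1) * (exp (- t * x\<^sup>2) * (- 2 * t * x))) = g x"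
      unfolding g_def weight_def pow by (simp add: algebra_simps power2_eq_square)
    ultimately show "(G has_vector_derivative g x) (at x)"
      by (simp only: has_real_derivative_iff_has_vector_derivative)
  qed simp
  then have "integral {-1..1} g = 0"
    by (simp add: G_def integral_unique)
  moreover have "integral {-1..1} g = integral {-1..1} (\<lambda>x. poly ((1 - X * X) * pderiv p) x * weight \<alpha> t x)
     - 2 * integral {-1..1} (\<lambda>x. poly ?V x * weight \<alpha> t x)"
    unfolding g_def
    by (subst integral_diff)
      (intro integrable_on_mult_right integrable_continuous_times_weight assms continuous_intros | simp)+
  ultimately show ?thesis
    by linarith
qed

text \<open>
  The integrand is nonnegative, and on \<open>[-1/2, 1/2]\<close>, away from the singular endpoints, it is
  continuous; its integral over that interval could vanish only if \<open>p\<close> had infinitely many roots.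
\<close>
lemma weighted_square_integral_pos:
  fixes \<alpha> t :: real
  assumes "\<alpha> > -1" and "p \<noteq> 0"
  shows "integral {-1..1} (\<lambda>x. poly (p * p) x * weight \<alpha> t x) > 0"
proof -
  let ?f = "\<lambda>x. poly (p * p) x * weight \<alpha> t x"
  have nonneg: "?f x \<ge> 0" for x
    by (simp add: weight_def)
  have cont: "continuous_on {-1/2..1/2} ?f"
  proof -
    have "1 - x\<^sup>2 \<noteq> 0" if "x \<in> {-1/2..1/2}" for x :: real
      using that abs_square_less_1[of x] by auto
    then show ?thesis
      unfolding weight_def by (intro continuous_intros) auto
  qed
  have "integral {-1/2..1/2} ?f \<noteq> 0"
  proof
    assume "integral {-1/2..1/2} ?f = 0"
    then have "\<forall>x\<in>{-1/2..1/2}. ?f x = 0"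
      using integral_eq_0_iff[OF cont] nonneg by simp
    then have "{-1/2..1/2} \<subseteq> {x. poly p x = 0}"
      by (auto simp: weight_def power2_eq_1_iff)
    moreover have "infinite {-1/2..1/2::real}"
      by (rule infinite_Icc) simp
    ultimately show False
      using poly_roots_finite[OF \<open>p \<noteq> 0\<close>] finite_subset by blast
  qed
  moreover have "integral {-1/2..1/2} ?f \<ge> 0"
    by (intro integral_nonneg integrable_continuous_real cont nonneg)
  moreover have "integral {-1/2..1/2} ?f \<le> integral {-1..1} ?f"
  proof (rule integral_subset_le)
    show "?f integrable_on {-1/2..1/2}"
      by (intro integrable_continuous_real cont)
    show "?f integrable_on {-1..1}"
      by (intro integrable_continuous_times_weight assms(1) continuous_intros)
  qed (use nonneg in auto)
  ultimately show ?thesis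
    by linarith
qed

section \<open>Moments and Kummer functions\<close>

definition even_moment :: "real \<Rightarrow> nat \<Rightarrow> real" where
  "even_moment \<alpha> k = integral {-1..1} (\<lambda>x. x ^ (2 * k) * weight \<alpha> 0 x)"

text \<open>
  The Pearson equation at \<open>t = 0\<close> for the monomial \<open>x\<^sup>2\<^sup>k\<^sup>+\<^sup>1\<close>.
\<close>
lemma even_moment_Suc:
  assumes "\<alpha> > -1"
  shows "(\<alpha> + 3 / 2 + real k) * even_moment \<alpha> (Suc k) = (1 / 2 + real k) * even_moment \<alpha> k"
proof -
  have "integral {-1..1} (\<lambda>x. (1 + 2 * real k) * (x ^ (2 * k) * weight \<alpha> 0 x)
        - (1 + 2 * real k) * (x ^ (2 * Suc k) * weight \<alpha> 0 x))
     = integral {-1..1} (\<lambda>x. poly ((1 - X * X) * pderiv (monom 1 (Suc (2 * k)))) x * weight \<alpha> 0 x)"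
    by (rule arg_cong[where f = "integral _"])
      (simp add: fun_eq_iff pderiv_monom poly_monom algebra_simps)
  also have "\<dots> = 2 * integral {-1..1} (\<lambda>x. (\<alpha> + 1) * (x ^ (2 * Suc k) * weight \<alpha> 0 x))"
    unfolding pearson_weight[OF assms]
    by (rule arg_cong[where f = "\<lambda>f. 2 * integral _ f"])
      (simp add: fun_eq_iff poly_monom algebra_simps)
  finally have "(1 + 2 * real k) * even_moment \<alpha> k - (1 + 2 * real k) * even_moment \<alpha> (Suc k)
      = 2 * ((\<alpha> + 1) * even_moment \<alpha> (Suc k))"
    unfolding even_moment_def
    by (subst (asm) integral_diff)
      (intro integrable_on_mult_right integrable_continuous_times_weight assms continuous_intros | simp)+
  then show ?thesis
    by (simp add: field_simps)
qed

lemma even_moment_eq: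
  assumes "\<alpha> > -1"
  shows "even_moment \<alpha> k = even_moment \<alpha> 0 * (pochhammer (1 / 2) k / pochhammer (3 / 2 + \<alpha>) k)"
proof (induction k)
  case (Suc k)
  have "even_moment \<alpha> (Suc k) = even_moment \<alpha> k * ((1 / 2 + real k) / (3 / 2 + \<alpha> + real k))"
    using even_moment_Suc[OF assms, of k] assms by (simp add: field_simps)
  then show ?case
    by (simp add: Suc pochhammer_Suc)
qed simp

lemma even_moment_pos:
  assumes "\<alpha> > -1" shows "even_moment \<alpha> 0 > 0"
  using weighted_square_integral_pos[of \<alpha> 1 0] assms by (simp add: even_moment_def)

text \<open>
  Expand \<open>exp (-t x\<^sup>2)\<close> and integrate term by term; the partial sums are dominated by
  \<open>exp \<bar>t\<bar> (1 - x\<^sup>2)\<^sup>\<alpha>\<close>.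
\<close>
lemma weighted_integral_sums:
  fixes \<alpha> t :: real
  assumes "\<alpha> > -1"
  shows "(\<lambda>k. even_moment \<alpha> (j + k) * ((- t) ^ k / fact k)) sums
           integral {-1..1} (\<lambda>x. x ^ (2 * j) * weight \<alpha> t x)"
proof -
  let ?f = "\<lambda>n x. \<Sum>k<n. (x ^ (2 * (j + k)) * weight \<alpha> 0 x) * ((- t) ^ k / fact k)"
  have int: "(\<lambda>x. (x ^ m * weight \<alpha> 0 x) * c) integrable_on {-1..1}" for m c
    by (intro integrable_on_mult_left integrable_continuous_times_weight assms continuous_intros)
  have "(\<lambda>n. integral {-1..1} (?f n)) \<longlonglongrightarrow> integral {-1..1} (\<lambda>x. x ^ (2 * j) * weight \<alpha> t x)"
  proof (rule dominated_convergence(2))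
    show "?f n integrable_on {-1..1}" for n
      by (intro integrable_sum int) auto
    show "(\<lambda>x. exp \<bar>t\<bar> * weight \<alpha> 0 x) integrable_on {-1..1}"
      by (intro integrable_continuous_times_weight assms continuous_intros)
    fix x :: real assume x: "x \<in> {-1..1}"
    have f_eq: "?f n x = (\<Sum>k<n. (- t * x\<^sup>2) ^ k /\<^sub>R fact k) * (x ^ (2 * j) * weight \<alpha> 0 x)" for n
    proof -
      have "(- t * x\<^sup>2) ^ k = (- t) ^ k * x ^ (2 * k)" for k
        by (simp only: power_mult_distrib power_mult)
      then show ?thesis
        unfolding sum_distrib_right by (intro sum.cong) (simp_all add: power_add field_simps)
    qed
    have w0: "weight \<alpha> 0 x \<ge> 0"
      by (simp add: weight_def)
    show "norm (?f n x) \<le> exp \<bar>t\<bar> * weight \<alpha> 0 x" for n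
    proof -
      have "norm (\<Sum>k<n. (- t * x\<^sup>2) ^ k /\<^sub>R fact k) \<le> (\<Sum>k<n. \<bar>t\<bar> ^ k /\<^sub>R fact k)"
      proof (rule sum_norm_le)
        fix k
        have "\<bar>t * x\<^sup>2\<bar> \<le> \<bar>t\<bar>"
          using x by (simp add: abs_mult mult_left_le abs_square_le_1 abs_le_iff)
        then have "\<bar>t * x\<^sup>2\<bar> ^ k \<le> \<bar>t\<bar> ^ k"
          by (intro power_mono) auto
        then show "norm ((- t * x\<^sup>2) ^ k /\<^sub>R fact k) \<le> \<bar>t\<bar> ^ k /\<^sub>R fact k"
          by (simp add: power_abs divide_right_mono field_simps)
      qed
      also have "\<dots> \<le> exp \<bar>t\<bar>"
        unfolding exp_def by (intro sum_le_suminf summable_exp_generic) auto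
      finally have "norm (\<Sum>k<n. (- t * x\<^sup>2) ^ k /\<^sub>R fact k) \<le> exp \<bar>t\<bar>" .
      moreover have "norm (x ^ (2 * j) * weight \<alpha> 0 x) \<le> weight \<alpha> 0 x"
        using x w0 by (simp add: abs_mult power_le_one_iff mult_left_le_one_le power_abs abs_le_iff)
      ultimately show ?thesis
        unfolding f_eq norm_mult[of "sum _ _"] by (intro mult_mono) auto
    qed
    have "(\<lambda>n. ?f n x) \<longlonglongrightarrow> exp (- t * x\<^sup>2) * (x ^ (2 * j) * weight \<alpha> 0 x)"
      unfolding f_eq using exp_converges[of "- t * x\<^sup>2"]
      by (intro tendsto_mult tendsto_const) (simp add: sums_def)
    then show "(\<lambda>n. ?f n x) \<longlonglongrightarrow> x ^ (2 * j) * weight \<alpha> t x"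
      by (simp add: weight_def mult_ac)
  qed
  moreover have "integral {-1..1} (?f n) = (\<Sum>k<n. even_moment \<alpha> (j + k) * ((- t) ^ k / fact k))" for n
    by (subst integral_sum) (simp_all only: int finite_lessThan even_moment_def integral_mult_left)
  ultimately show ?thesis
    by (simp add: sums_def)
qed

lemma integral_weight_kummer:
  fixes \<alpha> t :: real
  assumes "\<alpha> > -1"
  shows "integral {-1..1} (\<lambda>x. weight \<alpha> t x) = even_moment \<alpha> 0 * kummer (1 / 2) (3 / 2 + \<alpha>) (- t)"
proof -
  let ?a = "\<lambda>k. pochhammer (1 / 2) k / pochhammer (3 / 2 + \<alpha>) k * ((- t) ^ k / fact k)"
  have "(\<lambda>k. even_moment \<alpha> 0 * ?a k) sums integral {-1..1} (\<lambda>x. weight \<alpha> t x)"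
    using weighted_integral_sums[OF assms, of 0 t]
    by (subst (asm) even_moment_eq[OF assms]) (simp add: mult.assoc)
  from sums_mult[OF this, of "1 / even_moment \<alpha> 0"]
  have "?a sums (integral {-1..1} (\<lambda>x. weight \<alpha> t x) / even_moment \<alpha> 0)"
    using even_moment_pos[OF assms] by simp
  then show ?thesis
    unfolding kummer_def using even_moment_pos[OF assms] by (simp add: sums_iff)
qed

text \<open>
  The moment series is shifted by one here; \<open>(a)\<^sub>k\<^sub>+\<^sub>1 = a (a + 1)\<^sub>k\<close> turns it into the Kummer series with
  both parameters raised by one, and the factor \<open>(1/2) / (3/2 + \<alpha>) = 1 / (3 + 2 \<alpha>)\<close> comes out.
\<close>
lemma integral_sq_weight_kummer:
  fixes \<alpha> t :: real
  assumes "\<alpha> > -1"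
  shows "integral {-1..1} (\<lambda>x. x\<^sup>2 * weight \<alpha> t x) =
           even_moment \<alpha> 0 / (3 + 2 * \<alpha>) * kummer (3 / 2) (5 / 2 + \<alpha>) (- t)"
proof -
  let ?a = "\<lambda>k. pochhammer (3 / 2) k / pochhammer (5 / 2 + \<alpha>) k * ((- t) ^ k / fact k)"
  let ?c = "even_moment \<alpha> 0 / (3 + 2 * \<alpha>)"
  have "even_moment \<alpha> (1 + k) = ?c * (pochhammer (3 / 2) k / pochhammer (5 / 2 + \<alpha>) k)" for k
    using assms unfolding even_moment_eq[OF assms, of "1 + k"]
    by (simp add: pochhammer_rec add_ac divide_simps)
  then have *: "(\<lambda>k. ?c * ?a k) sums integral {-1..1} (\<lambda>x. x\<^sup>2 * weight \<alpha> t x)"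
    using weighted_integral_sums[OF assms, of 1 t] by (simp add: mult.assoc)
  have "?c \<noteq> 0"
    using even_moment_pos[OF assms] assms by simp
  with sums_divide[OF *, of ?c] have "?a sums (integral {-1..1} (\<lambda>x. x\<^sup>2 * weight \<alpha> t x) / ?c)"
    by (simp only: nonzero_mult_div_cancel_left not_False_eq_True)
  then show ?thesis
    unfolding kummer_def using even_moment_pos[OF assms] assms by (simp add: sums_iff)
qed

section \<open>The recurrence coefficients\<close>

theorem theorem2p2:
  fixes \<alpha> t :: real and P :: "nat \<Rightarrow> real poly" and h \<beta> :: "nat \<Rightarrow> real"
  assumes "\<alpha> > -1"
    and "monic_orthogonal_polys (weight \<alpha> t) P h"
    and "recurrence_coeffs P \<beta>"
  shows "(\<forall>n::nat. n \<ge> 1 \<longrightarrow>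
            (real n - 2 * t * \<beta> n)\<^sup>2 + 2 * \<alpha> * (real n - 2 * t * \<beta> n)
            - \<beta> n * (2 * real n - 1 + 2 * \<alpha> - 2 * t * \<beta> (n - 1) - 2 * t * \<beta> n)
                  * (2 * real n + 1 + 2 * \<alpha> - 2 * t * \<beta> n - 2 * t * \<beta> (n + 1)) = 0)
       \<and> \<beta> 0 = 0
       \<and> \<beta> 1 = kummer (3/2) (5/2 + \<alpha>) (- t) / ((3 + 2 * \<alpha>) * kummer (1/2) (3/2 + \<alpha>) (- t))"
proof -
  define L where "L p = integral {-1..1} (\<lambda>x. poly p x * weight \<alpha> t x)" for p
  note \<alpha> = assms(1)
  have degree_P: "degree (P n) = n" and lead_P: "lead_coeff (P n) = 1"
    and orth: "L (P m * P n) = (if m = n then h n else 0)" for m n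
    using assms(2) unfolding monic_orthogonal_polys_def L_def by (blast, blast, simp)
  have \<beta>0: "\<beta> 0 = 0" and rec: "X * P n = P (Suc n) + smult (\<beta> n) (P (n - 1))" for n
    using assms(3) unfolding recurrence_coeffs_def by (simp, cases n, auto)
  have int: "(\<lambda>x. poly p x * weight \<alpha> t x) integrable_on {-1..1}" for p
    by (intro integrable_continuous_times_weight \<alpha> continuous_intros)
  interpret semiclassical_functional L \<alpha> t P h \<beta>
  proof
    show "L (p + q) = L p + L q" for p q
      by (simp add: L_def ring_distribs integral_add int)
    show "L (smult c p) = c * L p" for c p
      by (simp add: L_def mult.assoc)
    show "L (p * p) > 0" if "p \<noteq> 0" for p
      unfolding L_def using \<alpha> that by (rule weighted_square_integral_pos)
    show "L ((1 - X * X) * pderiv p) = 2 * L ((smult (\<alpha> + 1 + t) X - smult t (X * X * X)) * p)" for p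
      unfolding L_def by (rule pearson_weight[OF \<alpha>])
  qed (fact degree_P lead_P orth \<beta>0 rec)+
  have "(real n - 2 * t * \<beta> n)\<^sup>2 + 2 * \<alpha> * (real n - 2 * t * \<beta> n)
      - \<beta> n * (2 * real n - 1 + 2 * \<alpha> - 2 * t * \<beta> (n - 1) - 2 * t * \<beta> n)
            * (2 * real n + 1 + 2 * \<alpha> - 2 * t * \<beta> n - 2 * t * \<beta> (n + 1)) = 0" if "n \<ge> 1" for n
  proof -
    obtain m where n: "n = Suc m"
      using \<open>n \<ge> 1\<close> by (cases n) auto
    have "R m = 2 * real n - 1 + 2 * \<alpha> - 2 * t * \<beta> (n - 1) - 2 * t * \<beta> n"
      by (simp add: R_def n)
    moreover have "R n = 2 * real n + 1 + 2 * \<alpha> - 2 * t * \<beta> n - 2 * t * \<beta> (n + 1)"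
      by (simp add: R_def)
    ultimately show ?thesis
      using difference_equation[of m] unfolding n[symmetric] S_def by simp
  qed
  moreover have "\<beta> 1 = kummer (3/2) (5/2 + \<alpha>) (- t) / ((3 + 2 * \<alpha>) * kummer (1/2) (3/2 + \<alpha>) (- t))"
  proof -
    have P0: "P 0 = 1"
      using degree_P[of 0] coeff_P[of 0] by (metis degree_eq_zeroE coeff_pCons_0 one_pCons)
    have P1: "P 1 = X"
      using rec[of 0] by (simp add: P0 \<beta>0)
    have "h 0 = even_moment \<alpha> 0 * kummer (1/2) (3/2 + \<alpha>) (- t)"
      using orth[of 0 0] integral_weight_kummer[OF \<alpha>, of t] by (simp add: L_def P0)
    moreover have "h 1 = even_moment \<alpha> 0 / (3 + 2 * \<alpha>) * kummer (3/2) (5/2 + \<alpha>) (- t)"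
      using orth[of 1 1] integral_sq_weight_kummer[OF \<alpha>, of t]
      unfolding P1 by (simp add: L_def power2_eq_square)
    ultimately show ?thesis
      using beta_Suc[of 0] even_moment_pos[OF \<alpha>] by simp
  qed
  ultimately show ?thesis
    using \<beta>0 by blast
qed

end
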